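(* Let $G=(V,E)$ be a finite simple graph with $V\neq\emptyset$ and let $\mathcal{C}\subseteq V$ be an independent set of $G$. The facets of $\mathbf{S}(G,\mathcal{C})$ are those defined by the inequalities $p_x\ge\sum_{y\sim x}p_y$ for all $x\in\mathcal{C}$ and $p_x\ge 0$ for all $x\in V\setminus\mathcal{C}$; that is, each of these inequalities defines a facet of $\mathbf{S}(G,\mathcal{C})$, and every facet of $\mathbf{S}(G,\mathcal{C})$ is defined by one of them.
   Context: Graphs are simple (no loops, no multiple edges) and undirected; $x\sim y$ means $(x,y)\in E$. A set of nodes is independent if it contains no two adjacent nodes. $\Delta(V)=\{p\in\mathbb{R}^V : p_x\ge 0 \text{ for all } x\in V,\ \sum_{x\in V}p_x=1\}$ is the set of probability distributions on $V$. A point $x\in V$ is a strong mode of $p\in\Delta(V)$ if $p_x\ge\sum_{y\sim x}p_y$ (sum over all neighbors $y$ of $x$). The polytope of strong $\mathcal{C}$-modes in $G$ is $\mathbf{S}(G,\mathcal{C})=\{p\in\Delta(V): \text{every } x\in\mathcal{C}\text{ is a strong mode of } p\}$. A valid inequality for a polytope $P$ defines a facet if the set of points of $P$ at which it holds with equality is a face of dimension $\dim P-1$ (with the usual convention $\dim\emptyset=-1$). *)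

theory Defs
  imports "HOL-Analysis.Analysis"
begin

text \<open>A nonempty finite simple graph is an adjacency relation on a vertex type of class
  \<open>finite\<close> (types are nonempty), so that the space of real vectors indexed by the
  vertices is the Euclidean space \<open>real ^ 'v\<close>.\<close>

definition simple_graph :: "('v \<Rightarrow> 'v \<Rightarrow> bool) \<Rightarrow> bool" where
  "simple_graph E \<longleftrightarrow> symp E \<and> irreflp E"

definition independent_set :: "('v \<Rightarrow> 'v \<Rightarrow> bool) \<Rightarrow> 'v set \<Rightarrow> bool" where
  "independent_set E C \<longleftrightarrow> (\<forall>x\<in>C. \<forall>y\<in>C. \<not> E x y)"

definition prob_simplex :: "(real ^ 'v::finite) set" where
  "prob_simplex = {p. (\<forall>x. p $ x \<ge> 0) \<and> (\<Sum>x\<in>UNIV. p $ x) = 1}"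

definition strong_mode :: "('v::finite \<Rightarrow> 'v \<Rightarrow> bool) \<Rightarrow> real ^ 'v \<Rightarrow> 'v \<Rightarrow> bool" where
  "strong_mode E p x \<longleftrightarrow> p $ x \<ge> (\<Sum>y | E x y. p $ y)"

definition strong_modes_polytope ::
    "('v::finite \<Rightarrow> 'v \<Rightarrow> bool) \<Rightarrow> 'v set \<Rightarrow> (real ^ 'v) set" where
  "strong_modes_polytope E C = {p \<in> prob_simplex. \<forall>x\<in>C. strong_mode E p x}"

text \<open>Unlike the library's \<open>facet_of\<close>, this admits the empty face as a facet of a
  one-point polytope: \<open>aff_dim {} = -1\<close> and \<open>aff_dim {p} = 0\<close>.  The difference matters
  exactly when the graph has a single vertex.\<close>

definition is_facet :: "'a::euclidean_space set \<Rightarrow> 'a set \<Rightarrow> bool" where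
  "is_facet F P \<longleftrightarrow> F face_of P \<and> aff_dim F = aff_dim P - 1"

text \<open>The inequality \<open>l p \<ge> r p\<close> is given by its two sides; the first conjunct says that
  it is an affine-linear inequality \<open>a \<bullet> p \<ge> b\<close>, the second that it is valid on \<open>P\<close>.\<close>

definition defines_facet ::
    "('a::euclidean_space \<Rightarrow> real) \<Rightarrow> ('a \<Rightarrow> real) \<Rightarrow> 'a set \<Rightarrow> bool" where
  "defines_facet l r P \<longleftrightarrow>
     (\<exists>a b. \<forall>p. l p - r p = a \<bullet> p - b) \<and>
     (\<forall>p\<in>P. l p \<ge> r p) \<and>
     is_facet {p \<in> P. l p = r p} P"

end

theory Submission
  imports Defs
begin

text \<open>Let \<open>g x p\<close> be the slack of the inequality at \<open>x\<close>.  Since \<open>C\<close> is independent, the linear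
  map \<open>p \<mapsto> (g x p)\<^sub>x\<close> is unitriangular; its inverse sends the unit vector at \<open>z\<close> to the 0/1 vector
  \<open>b z\<close> supported on \<open>z\<close> and the neighbours of \<open>z\<close> in \<open>C\<close>.  Hence the polytope is the simplex spanned
  by the normalised vectors \<open>b z\<close>, and the facet opposite the \<open>x\<close>-th vertex is where \<open>g x\<close> vanishes.\<close>

section \<open>Simplices with dual linear functionals\<close>

text \<open>The diagonal values \<open>g z (w z)\<close> are only required to be positive, since
  normalising the vertices to total mass 1 rescales them.\<close>

locale dual_simplex =
  fixes g :: "'v::finite \<Rightarrow> 'a::euclidean_space \<Rightarrow> real" and w :: "'v \<Rightarrow> 'a"
  assumes linear_g: "linear (g x)"
    and g_neq: "x \<noteq> z \<Longrightarrow> g x (w z) = 0"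
    and g_pos: "g z (w z) > 0"
begin

lemma inj_w: "inj w"
  by (metis g_neq g_pos injI less_irrefl)

text \<open>The kernel of \<open>g x\<close> is an affine set containing every vertex except
  \<open>w x\<close>, so \<open>w x\<close> is outside the affine hull of the others.\<close>

lemma affine_independent_w: "\<not> affine_dependent (range w)"
proof
  assume "affine_dependent (range w)"
  then obtain x where "w x \<in> affine hull (range w - {w x})"
    by (auto simp: affine_dependent_def)
  moreover have "affine hull (range w - {w x}) \<subseteq> {p. g x p = 0}"
  proof (rule hull_minimal)
    show "range w - {w x} \<subseteq> {p. g x p = 0}"
      using g_neq by force
    show "affine {p. g x p = 0}"
      using linear_g by (auto simp: affine_def linear_add linear_scale)
  qed
  ultimately show False
    using g_pos[of x] by auto
qed

lemma g_convex_combination: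
  "g x (\<Sum>z\<in>UNIV. u z *\<^sub>R w z) = u x * g x (w x)"
proof -
  have "g x (\<Sum>z\<in>UNIV. u z *\<^sub>R w z) = (\<Sum>z\<in>UNIV. u z * g x (w z))"
    using linear_g by (simp add: linear_sum linear_scale)
  also have "\<dots> = (\<Sum>z\<in>UNIV. if z = x then u x * g x (w x) else 0)"
    by (intro sum.cong) (auto simp: g_neq)
  finally show ?thesis by simp
qed

text \<open>Up to the positive factor \<open>g x (w x)\<close>, \<open>g x\<close> reads off the
  barycentric coordinate at \<open>w x\<close>; it vanishes exactly when that vertex carries no
  weight.\<close>

lemma zero_set_eq_opposite_face:
  "{p \<in> convex hull range w. g x p = 0} = convex hull (range w - {w x})"
proof (intro equalityI subsetI)
  fix p assume p: "p \<in> {p \<in> convex hull range w. g x p = 0}"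
  then obtain v where v: "\<forall>y\<in>range w. 0 \<le> v y" "sum v (range w) = 1"
      "(\<Sum>y\<in>range w. v y *\<^sub>R y) = p"
    by (auto simp: convex_hull_finite)
  have "p = (\<Sum>z\<in>UNIV. v (w z) *\<^sub>R w z)"
    using v(3) inj_w by (simp add: sum.reindex)
  then have "v (w x) = 0"
    using p g_pos[of x] by (simp add: g_convex_combination)
  then have "sum v (range w - {w x}) = 1" "(\<Sum>y\<in>range w - {w x}. v y *\<^sub>R y) = p"
    using v by (auto simp: sum_diff1)
  then show "p \<in> convex hull (range w - {w x})"
    using v(1) by (auto simp: convex_hull_finite)
next
  fix p assume "p \<in> convex hull (range w - {w x})"
  moreover have "convex hull (range w - {w x}) \<subseteq> {p. g x p = 0}"
  proof (rule hull_minimal)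
    show "range w - {w x} \<subseteq> {p. g x p = 0}"
      using g_neq by force
    show "convex {p. g x p = 0}"
      using linear_g by (auto simp: convex_def linear_add linear_scale)
  qed
  moreover have "convex hull (range w - {w x}) \<subseteq> convex hull range w"
    by (intro hull_mono) auto
  ultimately show "p \<in> {p \<in> convex hull range w. g x p = 0}"
    by auto
qed

text \<open>The case \<open>T = {}\<close> gives -1, so the empty facet of a one-point simplex is
  covered as well.\<close>

lemma aff_dim_convex_hull_subset:
  assumes "T \<subseteq> range w"
  shows "aff_dim (convex hull T) = int (card T) - 1"
  using affine_independent_w affine_independent_subset[OF _ assms]
  by (simp add: aff_dim_convex_hull aff_dim_affine_independent)

text \<open>Faces of a simplex are the hulls of subsets of its vertices, and a dimension drop of one
  means that exactly one vertex is left out.\<close>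

lemma is_facet_iff:
  "is_facet F (convex hull range w) \<longleftrightarrow> (\<exists>x. F = {p \<in> convex hull range w. g x p = 0})"
proof
  assume F: "is_facet F (convex hull range w)"
  then obtain T where T: "T \<subseteq> range w" "F = convex hull T"
    by (auto simp: is_facet_def face_of_convex_hull_affine_independent[OF affine_independent_w])
  then have "int (card (range w)) = int (card T) + 1"
    using F by (simp add: is_facet_def aff_dim_convex_hull_subset)
  then have "card (range w - T) = 1"
    using T(1) by (simp add: card_Diff_subset finite_subset[OF T(1)])
  then obtain y where y: "range w - T = {y}"
    by (rule card_1_singletonE)
  then obtain x where "y = w x"
    by blast
  with y T(1) have "T = range w - {w x}"
    by blast
  then show "\<exists>x. F = {p \<in> convex hull range w. g x p = 0}"
    using T(2) by (auto simp: zero_set_eq_opposite_face)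
next
  assume "\<exists>x. F = {p \<in> convex hull range w. g x p = 0}"
  then obtain x where x: "F = convex hull (range w - {w x})"
    by (auto simp: zero_set_eq_opposite_face)
  have "F face_of convex hull range w"
    unfolding x face_of_convex_hull_affine_independent[OF affine_independent_w] by blast
  moreover have "int (card (range w - {w x})) = int (card (range w)) - 1"
    by (simp add: card_Diff_singleton of_nat_diff card_gt_0_iff Suc_le_eq)
  then have "aff_dim F = aff_dim (convex hull range w) - 1"
    unfolding x by (subst (1 2) aff_dim_convex_hull_subset) auto
  ultimately show "is_facet F (convex hull range w)"
    by (simp add: is_facet_def)
qed

end

section \<open>The polytope of strong modes as a simplex\<close>

text \<open>Both kinds of inequality are merged into one family indexed by all vertices, to match
  the index type of \<open>dual_simplex\<close>.\<close>

definition slack :: "('v::finite \<Rightarrow> 'v \<Rightarrow> bool) \<Rightarrow> 'v set \<Rightarrow> 'v \<Rightarrow> real ^ 'v \<Rightarrow> real" where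
  "slack E C x p = p $ x - (if x \<in> C then \<Sum>y | E x y. p $ y else 0)"

text \<open>This is \<open>b z\<close>. For independent \<open>C\<close> the two indicators never
  overlap, as \<open>E z z\<close> fails for \<open>z\<close> in \<open>C\<close>.\<close>

definition slack_dual :: "('v::finite \<Rightarrow> 'v \<Rightarrow> bool) \<Rightarrow> 'v set \<Rightarrow> 'v \<Rightarrow> real ^ 'v" where
  "slack_dual E C z = (\<chi> x. of_bool (x = z) + of_bool (x \<in> C \<and> E x z))"

definition slack_mass :: "('v::finite \<Rightarrow> 'v \<Rightarrow> bool) \<Rightarrow> 'v set \<Rightarrow> 'v \<Rightarrow> real" where
  "slack_mass E C z = (\<Sum>x\<in>UNIV. slack_dual E C z $ x)"

definition slack_vertex :: "('v::finite \<Rightarrow> 'v \<Rightarrow> bool) \<Rightarrow> 'v set \<Rightarrow> 'v \<Rightarrow> real ^ 'v" where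
  "slack_vertex E C z = slack_dual E C z /\<^sub>R slack_mass E C z"

lemma linear_slack: "linear (slack E C x)"
  by (rule linearI) (auto simp: slack_def sum.distrib sum_distrib_left algebra_simps)

lemma sum_of_bool_eq_filter:
  fixes f :: "'v::finite \<Rightarrow> real"
  shows "(\<Sum>y | P y. f y * of_bool (y = z)) = of_bool (P z) * f z"
    and "(\<Sum>y\<in>UNIV. f y * of_bool (P y)) = (\<Sum>y | P y. f y)"
  by (auto simp: of_bool_def if_distrib sum.If_cases cong: if_cong)

lemma slack_mass_pos: "slack_mass E C z > 0"
  unfolding slack_mass_def
  by (rule sum_pos2[of _ z]) (auto simp: slack_dual_def)

context
  fixes E :: "'v::finite \<Rightarrow> 'v \<Rightarrow> bool" and C :: "'v set"
  assumes indep: "independent_set E C"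
begin

text \<open>For \<open>x\<close> in \<open>C\<close>, no neighbour of \<open>x\<close> lies in
  \<open>C\<close>, so the subtracted sum only detects whether \<open>z\<close> is a neighbour of
  \<open>x\<close>, and this cancels the second indicator.\<close>

lemma slack_slack_dual: "slack E C x (slack_dual E C z) = of_bool (x = z)"
proof (cases "x \<in> C")
  case True
  then have "(\<Sum>y | E x y. slack_dual E C z $ y) = (\<Sum>y | E x y. 1 * of_bool (y = z))"
    using indep by (intro sum.cong) (auto simp: slack_dual_def independent_set_def)
  then show ?thesis
    using True unfolding sum_of_bool_eq_filter by (simp add: slack_def slack_dual_def)
qed (simp add: slack_def slack_dual_def)

lemma slack_expansion: "p = (\<Sum>z\<in>UNIV. slack E C z p *\<^sub>R slack_dual E C z)"
proof (rule vec_eq_iff[THEN iffD2], rule allI)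
  fix x
  have "(\<Sum>z\<in>UNIV. slack E C z p *\<^sub>R slack_dual E C z) $ x
      = (\<Sum>z\<in>UNIV. slack E C z p * of_bool (z = x)) + (\<Sum>z\<in>UNIV. slack E C z p * of_bool (x \<in> C \<and> E x z))"
    by (simp add: slack_dual_def distrib_left sum.distrib eq_commute[of x])
  also have "\<dots> = slack E C x p + (\<Sum>z | x \<in> C \<and> E x z. slack E C z p)"
    using sum_of_bool_eq_filter(1)[where f = "\<lambda>z. slack E C z p" and P = "\<lambda>_. True" and z = x]
    by (simp add: sum_of_bool_eq_filter(2))
  \<comment> \<open>Neighbours of a point of \<open>C\<close> lie outside \<open>C\<close>, so their
    slacks are their coordinates; adding these restores what the slack at \<open>x\<close>
    subtracted.\<close>
  also have "(\<Sum>z | x \<in> C \<and> E x z. slack E C z p) = (\<Sum>z | x \<in> C \<and> E x z. p $ z)"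
    using indep by (intro sum.cong) (auto simp: slack_def independent_set_def)
  finally show "p $ x = (\<Sum>z\<in>UNIV. slack E C z p *\<^sub>R slack_dual E C z) $ x"
    by (simp add: slack_def)
qed

lemma sum_eq_slack_mass: "(\<Sum>x\<in>UNIV. p $ x) = (\<Sum>z\<in>UNIV. slack E C z p * slack_mass E C z)"
proof -
  have "(\<Sum>x\<in>UNIV. p $ x) = (\<Sum>x\<in>UNIV. \<Sum>z\<in>UNIV. slack E C z p * slack_dual E C z $ x)"
    by (subst slack_expansion) simp
  also have "\<dots> = (\<Sum>z\<in>UNIV. slack E C z p * slack_mass E C z)"
    by (subst sum.swap) (simp add: slack_mass_def sum_distrib_left)
  finally show ?thesis .
qed

lemma slack_slack_vertex:
  "slack E C x (slack_vertex E C z) = of_bool (x = z) / slack_mass E C z"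
  by (simp add: slack_vertex_def linear_scale[OF linear_slack] slack_slack_dual divide_inverse)

lemma slack_vertex_dual_simplex: "dual_simplex (slack E C) (slack_vertex E C)"
  by (rule dual_simplex.intro) (auto simp: linear_slack slack_slack_vertex slack_mass_pos)

text \<open>Nonnegativity of the coordinates in \<open>C\<close> is implied:
  \<open>slack_expansion\<close> writes \<open>p\<close> as a combination of 0/1 vectors with the
  slacks as coefficients.\<close>

lemma strong_modes_polytope_eq_slack:
  "strong_modes_polytope E C = {p. (\<forall>x. slack E C x p \<ge> 0) \<and> (\<Sum>x\<in>UNIV. p $ x) = 1}"
proof -
  have "p $ x \<ge> 0" if "\<And>z. slack E C z p \<ge> 0" for p x
  proof -
    have "(\<Sum>z\<in>UNIV. slack E C z p *\<^sub>R slack_dual E C z) $ x \<ge> 0"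
      using that by (auto simp: slack_dual_def intro!: sum_nonneg)
    then show ?thesis
      using slack_expansion[of p] by simp
  qed
  moreover have "(\<forall>x. slack E C x p \<ge> 0) \<longleftrightarrow> (\<forall>x\<in>C. strong_mode E p x) \<and> (\<forall>x\<in>-C. p $ x \<ge> 0)" for p
    by (auto simp: slack_def strong_mode_def)
  ultimately show ?thesis
    unfolding strong_modes_polytope_def prob_simplex_def by blast
qed

lemma strong_modes_polytope_eq_hull:
  "strong_modes_polytope E C = convex hull range (slack_vertex E C)" (is "?P = ?H")
proof (rule equalityI)
  show "?P \<subseteq> ?H"
  proof
    fix p assume p: "p \<in> ?P"
    \<comment> \<open>Barycentric coordinates of \<open>p\<close>: the mass undoes the division in
      \<open>slack_vertex\<close>, and \<open>sum_eq_slack_mass\<close> makes them sum to 1.\<close>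
    let ?u = "\<lambda>z. slack E C z p * slack_mass E C z"
    have "(\<Sum>z\<in>UNIV. ?u z *\<^sub>R slack_vertex E C z) \<in> ?H"
      using p slack_mass_pos[of E C] sum_eq_slack_mass[of p]
      by (intro convex_sum) (auto simp: strong_modes_polytope_eq_slack less_imp_le hull_inc)
    also have "(\<Sum>z\<in>UNIV. ?u z *\<^sub>R slack_vertex E C z) = (\<Sum>z\<in>UNIV. slack E C z p *\<^sub>R slack_dual E C z)"
      using slack_mass_pos[of E C, THEN less_imp_neq]
      by (intro sum.cong) (auto simp: slack_vertex_def)
    finally show "p \<in> ?H"
      using slack_expansion[of p] by simp
  qed
  show "?H \<subseteq> ?P"
  proof (rule hull_minimal)
    \<comment> \<open>Summed over \<open>x\<close>, these products give the total mass of the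
      vertex, namely 1.\<close>
    have "slack E C x (slack_vertex E C z) * slack_mass E C x = of_bool (x = z)" for x z
      using slack_mass_pos[of E C z] by (simp add: slack_slack_vertex)
    moreover have "slack E C x (slack_vertex E C z) \<ge> 0" for x z
      using slack_mass_pos[of E C z] by (simp add: slack_slack_vertex)
    ultimately show "range (slack_vertex E C) \<subseteq> ?P"
      by (auto simp: strong_modes_polytope_eq_slack sum_eq_slack_mass of_bool_def)
    show "convex ?P"
      unfolding strong_modes_polytope_eq_slack
      by (auto simp: convex_def linear_add[OF linear_slack] linear_scale[OF linear_slack]
          sum.distrib simp flip: sum_distrib_left)
  qed
qed

lemma is_facet_strong_modes_polytope_iff:
  "is_facet F (strong_modes_polytope E C) \<longleftrightarrow>
     (\<exists>x. F = {p \<in> strong_modes_polytope E C. slack E C x p = 0})"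
  unfolding strong_modes_polytope_eq_hull
  by (rule dual_simplex.is_facet_iff[OF slack_vertex_dual_simplex])

lemma defines_facet_slack:
  assumes "\<And>p. l p - r p = slack E C x p"
  shows "defines_facet l r (strong_modes_polytope E C)"
proof -
  \<comment> \<open>The adjoint at 1 is the vector representing the linear functional
    \<open>slack E C x\<close>; by linearity the constant is 0.\<close>
  have eq: "l p - r p = adjoint (slack E C x) 1 \<bullet> p - 0" for p
    using adjoint_works[OF linear_slack, of p E C x 1] assms by (simp add: inner_commute)
  have "l p = r p \<longleftrightarrow> slack E C x p = 0" for p
    using assms[of p] by auto
  then have "is_facet {p \<in> strong_modes_polytope E C. l p = r p} (strong_modes_polytope E C)"
    by (auto simp: is_facet_strong_modes_polytope_iff)
  moreover have "l p \<ge> r p" if "p \<in> strong_modes_polytope E C" for p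
    proof -
    have "slack E C x p \<ge> 0"
      using that by (simp add: strong_modes_polytope_eq_slack)
    then show ?thesis
      using assms[of p] by linarith
  qed
  ultimately show ?thesis
    unfolding defines_facet_def using eq by blast
qed

end

theorem proposition4:
  fixes E :: "'v::finite \<Rightarrow> 'v \<Rightarrow> bool" and C :: "'v set"
  assumes "simple_graph E"
    and "independent_set E C"
  shows "(\<forall>x\<in>C. defines_facet (\<lambda>p. p $ x) (\<lambda>p. \<Sum>y | E x y. p $ y) (strong_modes_polytope E C))
    \<and> (\<forall>x\<in>UNIV - C. defines_facet (\<lambda>p. p $ x) (\<lambda>p. 0) (strong_modes_polytope E C))
    \<and> (\<forall>F. is_facet F (strong_modes_polytope E C) \<longrightarrow>
          (\<exists>x\<in>C. F = {p \<in> strong_modes_polytope E C. p $ x = (\<Sum>y | E x y. p $ y)})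
        \<or> (\<exists>x\<in>UNIV - C. F = {p \<in> strong_modes_polytope E C. p $ x = 0}))"
proof (intro conjI ballI allI impI)
  show "defines_facet (\<lambda>p. p $ x) (\<lambda>p. \<Sum>y | E x y. p $ y) (strong_modes_polytope E C)" if "x \<in> C" for x
    using that by (intro defines_facet_slack[OF assms(2), of _ _ x]) (simp add: slack_def)
  show "defines_facet (\<lambda>p. p $ x) (\<lambda>p. 0) (strong_modes_polytope E C)" if "x \<in> UNIV - C" for x
    using that by (intro defines_facet_slack[OF assms(2), of _ _ x]) (simp add: slack_def)
next
  fix F assume "is_facet F (strong_modes_polytope E C)"
  then obtain x where x: "F = {p \<in> strong_modes_polytope E C. slack E C x p = 0}"
    using is_facet_strong_modes_polytope_iff[OF assms(2)] by blast
  then show "(\<exists>x\<in>C. F = {p \<in> strong_modes_polytope E C. p $ x = (\<Sum>y | E x y. p $ y)})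
      \<or> (\<exists>x\<in>UNIV - C. F = {p \<in> strong_modes_polytope E C. p $ x = 0})"
    by (cases "x \<in> C") (auto simp: slack_def)
qed

end
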